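(* Let $q\ge 4$ be a prime power. (1) The number of words of weight $5$ of the corner code $\mathsf{H}^{0}_4$ is $$A_5=\frac15 q^2\binom{q}{4}(q^3-4)(q^2-1)(q^2-4).$$ (2) For every $1\le j\le 3$, the number of words of weight $5$ of the edge code $\mathsf{H}^{j}_4$ is $$A_5=q^2(q-1)\binom{q+1}{5}(2q^3-4q^2-5q+16).$$
   Context: Let $\mathcal{H}$ be the Hermitian curve $x^{q+1}=y^q+y$ over $\mathbb{F}_{q^2}$, with its $n=q^3$ affine $\mathbb{F}_{q^2}$-rational points $P_1,\dots,P_n$. For a set $\mathcal{B}$ of monomials in $x,y$, the code with parity checks $\mathcal{B}$ is the set of $c\in(\mathbb{F}_{q^2})^n$ with $\sum_{i=1}^n c_i f(P_i)=0$ for all $f\in\mathcal{B}$. The Hermitian code $\mathsf{H}^{0}_4$ is the code with parity checks $\{1,x,y,x^2,xy,y^2\}$. For $1\le j\le3$, the code $\mathsf{H}^{j}_4$ has parity checks $\{1,x,y,x^2,xy,y^2\}$ together with the first $j$ of the monomials $x^3,\ x^2y,\ xy^2$. Each of these codes has minimum distance $4$. *)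

theory Defs
  imports
    Complex_Main
    "HOL-Library.FuncSet"
    "HOL-Library.Cardinality"
    "HOL-Number_Theory.Number_Theory"
begin

definition hermitian_curve :: "nat \<Rightarrow> ('a::field \<times> 'a) set" where
  "hermitian_curve q = {(x, y). x ^ (q + 1) = y ^ q + y}"

(* A monomial x^a y^b is represented by its pair of exponents (a, b). *)
type_synonym monomial = "nat \<times> nat"

definition eval_monomial :: "monomial \<Rightarrow> 'a::field \<times> 'a \<Rightarrow> 'a" where
  "eval_monomial m p = fst p ^ fst m * snd p ^ snd m"

(* Words of length n are functions on {1..n}; the extensional function space
   (value "undefined" outside {1..n}) contains each word exactly once. *)
definition words :: "nat \<Rightarrow> (nat \<Rightarrow> 'a) set" where
  "words n = {1..n} \<rightarrow>\<^sub>E UNIV"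

definition weight :: "nat \<Rightarrow> (nat \<Rightarrow> 'a::zero) \<Rightarrow> nat" where
  "weight n c = card {i \<in> {1..n}. c i \<noteq> 0}"

definition code_of_checks ::
    "nat \<Rightarrow> (nat \<Rightarrow> 'a::field \<times> 'a) \<Rightarrow> monomial set \<Rightarrow> (nat \<Rightarrow> 'a) set" where
  "code_of_checks n P B =
     {c \<in> words n. \<forall>f\<in>B. (\<Sum>i=1..n. c i * eval_monomial f (P i)) = 0}"

(* 1, x, y, x^2, xy, y^2 *)
definition corner_checks :: "monomial set" where
  "corner_checks = {(0,0), (1,0), (0,1), (2,0), (1,1), (0,2)}"

(* The first j of x^3, x^2 y, x y^2, in this order; H^j_4 is meant for j \<le> 3,
   and j = 0 gives the corner code. *)
definition H4_checks :: "nat \<Rightarrow> monomial set" where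
  "H4_checks j = corner_checks \<union> set (take j [(3,0), (2,1), (1,2)])"

definition H4 :: "nat \<Rightarrow> (nat \<Rightarrow> 'a::field \<times> 'a) \<Rightarrow> nat \<Rightarrow> (nat \<Rightarrow> 'a) set" where
  "H4 n P j = code_of_checks n P (H4_checks j)"

definition num_words_of_weight :: "nat \<Rightarrow> nat \<Rightarrow> (nat \<Rightarrow> 'a::zero) set \<Rightarrow> nat" where
  "num_words_of_weight n w C = card {c \<in> C. weight n c = w}"

end

theory Submission
  imports Defs "HOL-Computational_Algebra.Polynomial"
begin

text \<open>The support of a word of weight 5 is a set of five points on which the conics satisfy a linear
  dependency with no zero coefficient. Multiplying such a dependency by the equation of a line
  leaves a dependency of affine functions among the points off the line, and this forces the five
  points to be collinear. On a line the checks become the vanishing of the power sums of degree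
  \<open>< d\<close> in a coordinate, so the words on five given points are the full-weight words of an MDS code
  of dimension 2 (\<open>d = 3\<close>) or 1 (\<open>d = 4\<close>); the cubic checks give \<open>d = 4\<close> exactly on non-vertical
  lines, since none of them contains \<open>y\<^sup>3\<close>. The trace and norm of \<open>F\<^bsub>q\<^sup>2\<^esub>\<close> over \<open>F\<^bsub>q\<^esub>\<close> give the
  intersection numbers: each vertical line meets the curve in \<open>q\<close> points, and among the \<open>q\<^sup>4\<close>
  non-vertical lines, \<open>q\<^sup>3\<close> are tangent (one affine point) and the others meet it in \<open>q + 1\<close>
  points.\<close>

section \<open>Sections of the Hermitian curve by lines\<close>

text \<open>Multiplication by \<open>x\<close> permutes the nonzero elements, so it leaves their
  product unchanged.\<close>

lemma power_card_minus_one: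
  fixes x :: "'a::{field,finite}"
  assumes "x \<noteq> 0"
  shows "x ^ (CARD('a) - 1) = 1"
proof -
  have "(\<Prod>y\<in>-{0}. x * y) = \<Prod>(-{0::'a})"
    by (rule prod.reindex_bij_witness[of _ "\<lambda>y. y / x" "\<lambda>y. x * y"]) (use assms in auto)
  moreover have "(\<Prod>y\<in>-{0}. x * y) = x ^ (CARD('a) - 1) * \<Prod>(-{0::'a})"
    by (simp add: prod.distrib Compl_eq_Diff_UNIV)
  ultimately show ?thesis
    by simp
qed

text \<open>Root bound for a monic polynomial with lower-order part \<open>r\<close>. It supplies
  all upper bounds on the fibres of trace and norm and on their sets of values.\<close>

lemma card_roots_le:
  fixes r :: "'a::field poly"
  assumes "degree r < n"
  shows "card {x. x ^ n + poly r x = 0} \<le> n"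
proof -
  have "degree (monom 1 n + r) = n"
    using assms by (simp add: degree_add_eq_left degree_monom_eq)
  moreover from this have "monom 1 n + r \<noteq> 0"
    using assms by auto
  ultimately show ?thesis
    using card_poly_roots_bound[of "monom 1 n + r"] by (simp add: poly_monom)
qed

text \<open>Pigeonhole: at most \<open>m\<close> values with fibres of at most \<open>k\<close>
  elements can exhaust \<open>k * m\<close> elements only if every fibre is full. Exact fibre sizes
  of trace and norm thus follow from root bounds, without a separate proof of surjectivity.\<close>

lemma card_fibre_eq:
  assumes "finite A" "finite B" "f ` A \<subseteq> B"
    and "\<And>b. b \<in> B \<Longrightarrow> card {a \<in> A. f a = b} \<le> k"
    and "card B \<le> m" "k * m \<le> card A" "b \<in> B"
  shows "card {a \<in> A. f a = b} = k"
proof (rule ccontr)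
  assume "card {a \<in> A. f a = b} \<noteq> k"
  hence less: "card {a \<in> A. f a = b} < k"
    using assms(4,7) le_neq_implies_less by blast
  have "card A = (\<Sum>b\<in>B. card {a \<in> A. f a = b})"
    using assms(1-3) sum.group[of A B f "\<lambda>_. 1::nat"] by simp
  also have "\<dots> < (\<Sum>b\<in>B. k)"
    using assms less by (intro sum_strict_mono_ex1) auto
  also have "\<dots> \<le> k * m"
    using assms(5) by simp
  finally show False
    using assms(6) by simp
qed

section \<open>Frobenius, trace and norm on the field with \<open>q ^ 2\<close> elements\<close>

locale square_order_field =
  fixes q :: nat and ty :: "'a::{field,finite} itself"
  assumes primepow: "primepow q" and card_field: "CARD('a) = q ^ 2"
begin

lemma q_gt_1: "q > 1"
  using primepow primepow_gt_Suc_0 by simp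

text \<open>The characteristic divides the cardinality of the field, a power of the prime underlying
  \<open>q\<close>, so the two primes agree. Additivity of \<open>z \<mapsto> z ^ q\<close> rests on
  this.\<close>

lemma q_eq_CHAR_power: obtains k where "q = CHAR('a) ^ k" "prime CHAR('a)"
proof -
  have prime: "prime CHAR('a)"
    by (rule prime_CHAR_semidom) (simp add: finite_imp_CHAR_pos)
  from primepow obtain p k where pk: "prime p" "q = p ^ k"
    unfolding primepow_def by blast
  have "CHAR('a) dvd p ^ (k * 2)"
    using CHAR_dvd_CARD[where 'a = 'a] card_field pk by (simp add: power_mult)
  hence "CHAR('a) = p"
    using prime pk(1) prime_dvd_power primes_dvd_imp_eq by blast
  thus ?thesis
    using that pk prime by simp
qed

lemma power_q_add: "((x::'a) + y) ^ q = x ^ q + y ^ q"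
  by (metis q_eq_CHAR_power freshmans_dream')

lemma power_q_minus: "(- (x::'a)) ^ q = - (x ^ q)"
proof -
  have "x ^ q + (- x) ^ q = 0"
    using power_q_add[of x "- x"] q_gt_1 by (simp add: power_0_left)
  thus ?thesis
    by (simp add: eq_neg_iff_add_eq_0 add.commute)
qed

lemma power_q_diff: "((x::'a) - y) ^ q = x ^ q - y ^ q"
  using power_q_add[of x "- y"] by (simp add: power_q_minus)

text \<open>The \<open>q\<close>-power map is an involution because its square is
  \<open>x \<mapsto> x ^ CARD('a)\<close>. Hence it fixes all values of trace and norm.\<close>

lemma power_q_power_q: "((x::'a) ^ q) ^ q = x"
proof (cases "x = 0")
  case False
  have "(x ^ q) ^ q = x ^ Suc (CARD('a) - 1)"
    using q_gt_1 by (simp add: card_field power2_eq_square power_mult)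
  thus ?thesis
    using power_card_minus_one[OF False] by (simp only: power_Suc) simp
qed (use q_gt_1 in simp)

text \<open>\<open>y ^ q + y\<close> is the trace to the subfield \<open>{z. z ^ q = z}\<close>.
  Subfield and fibres have at most \<open>q\<close> elements each and the domain has
  \<open>q ^ 2\<close>, so every fibre is full.\<close>

lemma card_trace_fibre:
  assumes "c ^ q = (c::'a)"
  shows "card {y::'a. y ^ q + y = c} = q"
proof -
  have "card {y \<in> UNIV. y ^ q + y = c} = q"
  proof (rule card_fibre_eq[where B = "{z. z ^ q = z}"])
    show "(\<lambda>y::'a. y ^ q + y) ` UNIV \<subseteq> {z. z ^ q = z}"
      by (auto simp: power_q_add power_q_power_q)
    show "card {y \<in> UNIV. y ^ q + y = b} \<le> q" for b :: 'a
      using card_roots_le[of "[:-b, 1:]" q] q_gt_1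
      by (simp add: algebra_simps eq_neg_iff_add_eq_0 flip: eq_iff_diff_eq_0)
    show "card {z::'a. z ^ q = z} \<le> q"
      using card_roots_le[of "[:0, -1::'a:]" q] q_gt_1 by simp
  qed (use assms card_field in \<open>auto simp: power2_eq_square\<close>)
  thus ?thesis by simp
qed

text \<open>\<open>x ^ (q + 1)\<close> is the norm. Nonzero elements go to the roots of
  \<open>z ^ (q - 1) = 1\<close>, at most \<open>q - 1\<close> values with fibres of at most
  \<open>q + 1\<close>, and \<open>(q + 1) * (q - 1)\<close> is the number of nonzero
  elements.\<close>

lemma card_norm_fibre:
  assumes "c ^ q = (c::'a)"
  shows "card {x::'a. x ^ (q + 1) = c} = (if c = 0 then 1 else q + 1)"
proof (cases "c = 0")
  case False
  have "card {x \<in> -{0}. x ^ (q + 1) = c} = q + 1"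
  proof (rule card_fibre_eq[where B = "{z. z ^ (q - 1) = 1}"])
    show "(\<lambda>x::'a. x ^ (q + 1)) ` (-{0}) \<subseteq> {z. z ^ (q - 1) = 1}"
    proof clarify
      fix x :: 'a assume "x \<noteq> 0"
      have "(q + 1) * (q - 1) = CARD('a) - 1"
        by (simp add: card_field algebra_simps power2_eq_square)
      thus "(x ^ (q + 1)) ^ (q - 1) = 1"
        using power_card_minus_one[OF \<open>x \<noteq> 0\<close>] by (metis power_mult)
    qed
    show "card {x \<in> -{0}. x ^ (q + 1) = b} \<le> q + 1" for b :: 'a
    proof -
      have "card {x \<in> -{0}. x ^ (q + 1) = b} \<le> card {x. x ^ (q + 1) = b}"
        by (intro card_mono) auto
      also have "\<dots> \<le> q + 1"
        using card_roots_le[of "[:-b:]" "q + 1"] by (simp add: algebra_simps)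
      finally show ?thesis .
    qed
    show "card {z::'a. z ^ (q - 1) = 1} \<le> q - 1"
      using card_roots_le[of "[:-1::'a:]" "q - 1"] q_gt_1 by simp
    show "(q + 1) * (q - 1) \<le> card (-{0::'a})"
      by (simp add: card_field Compl_eq_Diff_UNIV algebra_simps power2_eq_square)
    \<comment> \<open>Cancelling the nonzero \<open>c\<close> in \<open>c ^ q = c\<close> puts
      \<open>c\<close> among these roots.\<close>
    have "c * c ^ (q - 1) = c"
      using assms q_gt_1 by (metis power_eq_if not_one_less_zero)
    thus "c \<in> {z. z ^ (q - 1) = 1}"
      using False by simp
  qed auto
  also have "{x \<in> -{0}. x ^ (q + 1) = c} = {x. x ^ (q + 1) = c}"
    using False by auto
  finally show ?thesis
    using False by simp
next
  case True
  hence "{x. x ^ (q + 1) = c} = {0}"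
    by auto
  thus ?thesis
    using True by simp
qed

text \<open>For fixed \<open>x = a\<close> one side of the curve equation is a trace in
  \<open>y\<close>; the other, \<open>a ^ (q + 1)\<close>, is a norm and hence fixed by the
  \<open>q\<close>-power map.\<close>

lemma card_curve_vertical:
  "card {y. (a::'a, y) \<in> hermitian_curve q} = q"
proof -
  have "(a ^ (q + 1)) ^ q = a ^ (q + 1)"
    by (simp add: power_mult_distrib power_q_power_q mult.commute)
  from card_trace_fibre[OF this] show ?thesis
    by (simp add: hermitian_curve_def eq_commute)
qed

text \<open>Completing the norm: on \<open>y = m x + b\<close> the curve equation reads
  \<open>(x - m\<^sup>q)\<^sup>q\<^sup>+\<^sup>1 = b\<^sup>q + b + m\<^sup>q\<^sup>+\<^sup>1\<close>.\<close>

lemma card_curve_nonvertical: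
  fixes m b :: 'a
  shows "card {x. (x, m * x + b) \<in> hermitian_curve q} =
    (if b ^ q + b = - (m ^ (q + 1)) then 1 else q + 1)"
proof -
  define c where "c = b ^ q + b + m ^ (q + 1)"
  have eq: "(x, m * x + b) \<in> hermitian_curve q \<longleftrightarrow> (x - m ^ q) ^ (q + 1) = c" for x
    by (simp add: hermitian_curve_def c_def power_q_diff power_q_add power_q_power_q
        power_mult_distrib algebra_simps)
  have "card {x. (x, m * x + b) \<in> hermitian_curve q} = card {x. x ^ (q + 1) = c}"
    unfolding eq
    by (rule bij_betw_same_card[of "\<lambda>x. x - m ^ q"],
        rule bij_betw_byWitness[where f' = "\<lambda>x. x + m ^ q"]) auto
  also have "c ^ q = c"
    by (simp add: c_def power_q_add power_q_power_q power_mult_distrib algebra_simps)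
  hence "card {x. x ^ (q + 1) = c} = (if c = 0 then 1 else q + 1)"
    by (rule card_norm_fibre)
  also have "c = 0 \<longleftrightarrow> b ^ q + b = - (m ^ (q + 1))"
    by (simp add: c_def eq_neg_iff_add_eq_0)
  finally show ?thesis .
qed

text \<open>These pairs are the lines that meet the curve once by
  \<open>card_curve_nonvertical\<close>. For each of the \<open>q ^ 2\<close> slopes the intercepts
  form a trace fibre.\<close>

lemma card_tangents:
  "card {(m::'a, b). b ^ q + b = - (m ^ (q + 1))} = q ^ 3"
proof -
  have "card {b::'a. b ^ q + b = - (m ^ (q + 1))} = q" for m :: 'a
    by (rule card_trace_fibre)
       (simp add: power_q_minus power_mult_distrib power_q_power_q mult.commute)
  hence "card (SIGMA m:UNIV. {b::'a. b ^ q + b = - (m ^ (q + 1))}) = (\<Sum>m\<in>(UNIV::'a set). q)"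
    by (subst card_SigmaI) auto
  also have "\<dots> = q ^ 3"
    by (simp add: card_field power2_eq_square power3_eq_cube)
  also have "(SIGMA m:UNIV. {b::'a. b ^ q + b = - (m ^ (q + 1))}) =
      {(m, b). b ^ q + b = - (m ^ (q + 1))}"
    by auto
  finally show ?thesis .
qed

end

section \<open>Full-weight words of Vandermonde codes\<close>

text \<open>The first \<open>d\<close> rows of the Vandermonde matrix with nodes \<open>t i\<close>,
  used as parity checks. For distinct nodes and \<open>d \<le> card I\<close> the solutions form a
  generalised Reed-Solomon code.\<close>

definition power_sums_vanish :: "'b set \<Rightarrow> ('b \<Rightarrow> 'a::field) \<Rightarrow> nat \<Rightarrow> ('b \<Rightarrow> 'a) \<Rightarrow> bool" where
  "power_sums_vanish I t d c \<longleftrightarrow> (\<forall>k<d. (\<Sum>i\<in>I. c i * t i ^ k) = 0)"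

lemma power_sums_vanish_poly:
  assumes "power_sums_vanish I t d c" "degree p < d"
  shows "(\<Sum>i\<in>I. c i * poly p (t i)) = 0"
proof -
  have "(\<Sum>i\<in>I. c i * poly p (t i)) = (\<Sum>k\<le>degree p. coeff p k * (\<Sum>i\<in>I. c i * t i ^ k))"
    by (simp add: poly_altdef sum_distrib_left sum.swap[of _ I] mult.left_commute)
  also have "\<dots> = 0"
    using assms by (intro sum.neutral) (auto simp: power_sums_vanish_def)
  finally show ?thesis .
qed

lemma power_sums_vanish_subset:
  assumes "finite I" "J \<subseteq> I" "\<And>i. i \<in> I - J \<Longrightarrow> c i = 0"
  shows "power_sums_vanish J t d c \<longleftrightarrow> power_sums_vanish I t d c"
proof -
  have "(\<Sum>i\<in>J. c i * t i ^ k) = (\<Sum>i\<in>I. c i * t i ^ k)" for k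
    using assms by (intro sum.mono_neutral_left) auto
  thus ?thesis
    by (simp add: power_sums_vanish_def)
qed

lemma power_sums_vanish_cong:
  assumes "\<And>i. i \<in> I \<Longrightarrow> c i = c' i"
  shows "power_sums_vanish I t d c \<longleftrightarrow> power_sums_vanish I t d c'"
  using assms by (simp add: power_sums_vanish_def)

text \<open>Test \<open>c\<close> against the product of the \<open>X - t j\<close> over
  \<open>j \<noteq> i\<close>: its degree is below \<open>d\<close>, and among the nodes only
  \<open>t i\<close> is not a root. Together with \<open>power_sums_vanish_subset\<close>, nonzero
  words have weight above \<open>d\<close>.\<close>

lemma power_sums_vanish_imp_zero:
  assumes "finite I" "inj_on t I" "card I \<le> d" "power_sums_vanish I t d c" "i \<in> I"
  shows "c i = 0"
proof -
  define p where "p = (\<Prod>j\<in>I - {i}. [:- t j, 1:])"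
  have "degree p = card (I - {i})"
    by (simp add: p_def degree_prod_eq_sum_degree)
  also have "\<dots> < d"
    using assms by (metis card_Diff1_less order_less_le_trans)
  finally have "(\<Sum>j\<in>I. c j * poly p (t j)) = 0"
    by (rule power_sums_vanish_poly[OF assms(4)])
  also have "(\<Sum>j\<in>I. c j * poly p (t j)) = (\<Sum>j\<in>{i}. c j * poly p (t j))"
    using assms(1,5) by (intro sum.mono_neutral_right) (auto simp: p_def poly_prod)
  finally have "c i * poly p (t i) = 0"
    by simp
  moreover have "poly p (t i) \<noteq> 0"
    using assms(1,2,5) by (auto simp: p_def poly_prod inj_on_def)
  ultimately show ?thesis
    by simp
qed

text \<open>The square Vandermonde map is injective between finite sets of equal size, hence
  onto.\<close>

lemma power_sums_surj:
  fixes t :: "'b \<Rightarrow> 'a::{field,finite}"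
  assumes "finite J" "inj_on t J"
  shows "\<exists>c. \<forall>k<card J. (\<Sum>i\<in>J. c i * t i ^ k) = w k"
proof -
  define d where "d = card J"
  define F where "F c = (\<lambda>k\<in>{..<d}. \<Sum>i\<in>J. c i * t i ^ k)" for c
  have F: "F ` (J \<rightarrow>\<^sub>E UNIV) \<subseteq> {..<d} \<rightarrow>\<^sub>E UNIV"
    by (auto simp: F_def split: if_splits)
  have "inj_on F (J \<rightarrow>\<^sub>E UNIV)"
  proof (rule inj_onI)
    fix c c' assume cc': "c \<in> J \<rightarrow>\<^sub>E UNIV" "c' \<in> J \<rightarrow>\<^sub>E UNIV" "F c = F c'"
    have "(\<Sum>i\<in>J. (c i - c' i) * t i ^ k) = 0" if "k < d" for k
      using fun_cong[OF cc'(3), of k] that by (simp add: F_def left_diff_distrib sum_subtractf)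
    hence "power_sums_vanish J t d (\<lambda>i. c i - c' i)"
      by (simp add: power_sums_vanish_def)
    hence "c i - c' i = 0" if "i \<in> J" for i
      using power_sums_vanish_imp_zero assms that d_def by (metis order_refl)
    thus "c = c'"
      using cc' by (intro PiE_ext) auto
  qed
  hence "card (F ` (J \<rightarrow>\<^sub>E UNIV)) = card ({..<d} \<rightarrow>\<^sub>E (UNIV :: 'a set))"
    using assms(1) by (simp add: card_image card_PiE d_def)
  hence "F ` (J \<rightarrow>\<^sub>E UNIV) = {..<d} \<rightarrow>\<^sub>E UNIV"
    using F by (intro card_subset_eq) (auto intro: finite_PiE)
  moreover have "restrict w {..<d} \<in> {..<d} \<rightarrow>\<^sub>E UNIV"
    by simp
  ultimately obtain c where "F c = restrict w {..<d}"
    by (metis imageE)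
  hence "(\<Sum>i\<in>J. c i * t i ^ k) = w k" if "k < d" for k
    using that by (auto simp: F_def dest: fun_cong[of _ _ k])
  thus ?thesis
    by (auto simp: d_def)
qed

text \<open>The coordinates outside a \<open>d\<close>-element set \<open>J\<close> can be chosen
  freely, and those on \<open>J\<close> are then determined.\<close>

lemma card_power_sums_vanish:
  fixes t :: "'b \<Rightarrow> 'a::{field,finite}"
  assumes "finite I" "inj_on t I" "d \<le> card I"
  shows "card {c \<in> I \<rightarrow>\<^sub>E UNIV. power_sums_vanish I t d c} = CARD('a) ^ (card I - d)"
proof -
  obtain J where J: "J \<subseteq> I" "card J = d"
    using assms by (meson obtain_subset_with_card_n)
  have fin: "finite J"
    using J(1) assms(1) by (rule finite_subset)
  have inj: "inj_on t J"
    using J(1) assms(2) by (meson inj_on_subset)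
  have split: "(\<Sum>i\<in>I. c i * t i ^ k) = (\<Sum>i\<in>J. c i * t i ^ k) + (\<Sum>i\<in>I-J. c i * t i ^ k)"
    for c :: "'b \<Rightarrow> 'a" and k
    using assms(1) J(1) by (subst sum.subset_diff[of J]) auto
  have "bij_betw (\<lambda>c. restrict c (I - J)) {c \<in> I \<rightarrow>\<^sub>E UNIV. power_sums_vanish I t d c}
      ((I - J) \<rightarrow>\<^sub>E UNIV)"
    unfolding bij_betw_def
  proof (intro conjI inj_onI equalityI subsetI)
    fix c c'
    assume c: "c \<in> {c \<in> I \<rightarrow>\<^sub>E UNIV. power_sums_vanish I t d c}"
      and c': "c' \<in> {c \<in> I \<rightarrow>\<^sub>E UNIV. power_sums_vanish I t d c}"
      and eq: "restrict c (I - J) = restrict c' (I - J)"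
    have eq': "c i = c' i" if "i \<in> I - J" for i
      using eq that by (metis restrict_apply')
    have "power_sums_vanish I t d (\<lambda>i. c i - c' i)"
      using c c' by (simp add: power_sums_vanish_def left_diff_distrib sum_subtractf)
    hence "power_sums_vanish J t d (\<lambda>i. c i - c' i)"
      using power_sums_vanish_subset[OF assms(1) J(1), of "\<lambda>i. c i - c' i"] eq' by simp
    hence "c i - c' i = 0" if "i \<in> J" for i
      using power_sums_vanish_imp_zero[OF fin inj] J(2) that by blast
    with eq' have "c i = c' i" if "i \<in> I" for i
      using that by (cases "i \<in> J") auto
    thus "c = c'"
      using c c' by (intro PiE_ext[of c I "\<lambda>_. UNIV" c']) auto
  next
    fix u :: "'b \<Rightarrow> 'a" assume u: "u \<in> (I - J) \<rightarrow>\<^sub>E UNIV"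
    \<comment> \<open>The square system on \<open>J\<close> is solved so as to cancel the
      contribution of the free coordinates \<open>u\<close>.\<close>
    obtain v where v: "\<And>k. k < d \<Longrightarrow> (\<Sum>i\<in>J. v i * t i ^ k) = - (\<Sum>i\<in>I-J. u i * t i ^ k)"
      using power_sums_surj[OF fin inj, of "\<lambda>k. - (\<Sum>i\<in>I-J. u i * t i ^ k)"] J(2) by auto
    define c where "c = (\<lambda>i\<in>I. if i \<in> J then v i else u i)"
    have "(\<Sum>i\<in>I. c i * t i ^ k) = 0" if "k < d" for k
    proof -
      have "(\<Sum>i\<in>J. c i * t i ^ k) = (\<Sum>i\<in>J. v i * t i ^ k)"
        using J(1) by (intro sum.cong) (auto simp: c_def)
      moreover have "(\<Sum>i\<in>I-J. c i * t i ^ k) = (\<Sum>i\<in>I-J. u i * t i ^ k)"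
        by (intro sum.cong) (auto simp: c_def)
      ultimately show ?thesis
        using v[OF that] by (simp add: split)
    qed
    hence "c \<in> {c \<in> I \<rightarrow>\<^sub>E UNIV. power_sums_vanish I t d c}"
      by (simp add: power_sums_vanish_def c_def)
    moreover have "u = restrict c (I - J)"
      using u by (auto simp: c_def PiE_def extensional_def restrict_def)
    ultimately show "u \<in> (\<lambda>c. restrict c (I - J)) ` {c \<in> I \<rightarrow>\<^sub>E UNIV. power_sums_vanish I t d c}"
      unfolding image_def by blast
  qed auto
  hence "card {c \<in> I \<rightarrow>\<^sub>E UNIV. power_sums_vanish I t d c} = card ((I - J) \<rightarrow>\<^sub>E (UNIV::'a set))"
    by (rule bij_betw_same_card)
  also have "\<dots> = CARD('a) ^ (card I - d)"
    using assms(1) J fin by (simp add: card_PiE card_Diff_subset)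
  finally show ?thesis .
qed

text \<open>The code has dimension 1, and a word with a zero coordinate lives on \<open>d\<close>
  nodes and so vanishes. Every nonzero word therefore has full weight.\<close>

lemma card_nonzero_power_sums_vanish_1:
  fixes t :: "'b \<Rightarrow> 'a::{field,finite}"
  assumes "finite I" "inj_on t I" "card I = d + 1"
  shows "card {c \<in> I \<rightarrow>\<^sub>E -{0}. power_sums_vanish I t d c} = CARD('a) - 1"
proof -
  let ?K = "{c \<in> I \<rightarrow>\<^sub>E UNIV. power_sums_vanish I t d c}"
  have "{c \<in> I \<rightarrow>\<^sub>E -{0}. power_sums_vanish I t d c} = ?K - {\<lambda>i\<in>I. 0}" (is "?L = ?R")
  proof (intro equalityI subsetI)
    fix c assume "c \<in> ?L"
    moreover from assms(3) obtain i where "i \<in> I"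
      by fastforce
    ultimately show "c \<in> ?R"
      by (auto simp: PiE_def Pi_def)
  next
    fix c assume c: "c \<in> ?R"
    have "c i \<noteq> 0" if "i \<in> I" for i
    proof
      assume "c i = 0"
      hence "power_sums_vanish (I - {i}) t d c"
        using c power_sums_vanish_subset[OF assms(1), of "I - {i}" c] by auto
      hence "c j = 0" if "j \<in> I - {i}" for j
        using assms \<open>i \<in> I\<close> that
        by (intro power_sums_vanish_imp_zero[of "I - {i}" t d]) (auto intro: inj_on_subset)
      with \<open>c i = 0\<close> have "c j = 0" if "j \<in> I" for j
        using that by (cases "j = i") auto
      hence "c = (\<lambda>i\<in>I. 0)"
        using c by (intro PiE_ext[of c I "\<lambda>_. UNIV"]) auto
      thus False
        using c by simp
    qed
    thus "c \<in> ?L"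
      using c by (auto simp: PiE_def Pi_def)
  qed
  also have "card \<dots> = CARD('a) - 1"
    using assms card_power_sums_vanish[of I t d]
    by (subst card_Diff_singleton) (auto simp: power_sums_vanish_def intro: finite_PiE)
  finally show ?thesis .
qed

text \<open>Of the \<open>CARD('a) ^ 2\<close> words, remove the zero word and, for each of the
  \<open>d + 2\<close> coordinates, the \<open>CARD('a) - 1\<close> words that vanish there only.
  Two zero coordinates already force the zero word.\<close>

lemma card_nonzero_power_sums_vanish_2:
  fixes t :: "'b \<Rightarrow> 'a::{field,finite}"
  assumes "finite I" "inj_on t I" "card I = d + 2"
  shows "real (card {c \<in> I \<rightarrow>\<^sub>E -{0}. power_sums_vanish I t d c}) =
    (real CARD('a) - 1) * (real CARD('a) - 1 - real d)"
proof -
  let ?K = "{c \<in> I \<rightarrow>\<^sub>E UNIV. power_sums_vanish I t d c}"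
  let ?L = "{c \<in> I \<rightarrow>\<^sub>E -{0}. power_sums_vanish I t d c}"
  define Z where "Z i = {c \<in> ?K. c i = 0 \<and> (\<forall>j\<in>I-{i}. c j \<noteq> 0)}" for i
  have finK: "finite ?K"
    by (rule finite_subset[OF _ finite_PiE[OF assms(1), of "\<lambda>_. UNIV"]]) auto
  have finZ: "finite (Z i)" for i
    by (rule finite_subset[OF _ finK]) (auto simp: Z_def)
  have card_Z: "card (Z i) = CARD('a) - 1" if "i \<in> I" for i
  proof -
    let ?J = "I - {i}"
    let ?M = "{c \<in> ?J \<rightarrow>\<^sub>E -{0}. power_sums_vanish ?J t d c}"
    \<comment> \<open>Dropping the zero at \<open>i\<close> leaves a full-weight word on
      \<open>d + 1\<close> nodes, the case counted before.\<close>
    have "bij_betw (\<lambda>c. restrict c ?J) (Z i) ?M"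
    proof (rule bij_betw_byWitness[where f' = "\<lambda>c. c(i := 0)"])
      show "\<forall>c\<in>Z i. (restrict c ?J)(i := 0) = c"
        using that by (auto simp: Z_def fun_eq_iff PiE_def extensional_def)
      show "\<forall>c\<in>?M. restrict (c(i := 0)) ?J = c"
        by (auto simp: fun_eq_iff PiE_def extensional_def)
      show "(\<lambda>c. restrict c ?J) ` Z i \<subseteq> ?M"
      proof clarify
        fix c assume c: "c \<in> Z i"
        hence "power_sums_vanish ?J t d c"
          using power_sums_vanish_subset[OF assms(1), of ?J c] by (auto simp: Z_def)
        hence "power_sums_vanish ?J t d (restrict c ?J)"
          using power_sums_vanish_cong[of ?J c "restrict c ?J"] by simp
        thus "restrict c ?J \<in> ?J \<rightarrow>\<^sub>E -{0} \<and> power_sums_vanish ?J t d (restrict c ?J)"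
          using c by (auto simp: Z_def)
      qed
      show "(\<lambda>c. c(i := 0)) ` ?M \<subseteq> Z i"
      proof clarify
        fix c assume c: "c \<in> ?J \<rightarrow>\<^sub>E -{0}" "power_sums_vanish ?J t d c"
        have "power_sums_vanish ?J t d (c(i := 0))"
          using c(2) power_sums_vanish_cong[of ?J c "c(i := 0)"] by auto
        hence "power_sums_vanish I t d (c(i := 0))"
          using power_sums_vanish_subset[OF assms(1), of ?J "c(i := 0)"] by auto
        thus "c(i := 0) \<in> Z i"
          using c(1) that by (auto simp: Z_def PiE_def Pi_def extensional_def)
      qed
    qed
    hence "card (Z i) = card ?M"
      by (rule bij_betw_same_card)
    also have "\<dots> = CARD('a) - 1"
      using assms that by (intro card_nonzero_power_sums_vanish_1) (auto intro: inj_on_subset)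
    finally show ?thesis .
  qed
  have K: "?K = ?L \<union> ({\<lambda>i\<in>I. 0} \<union> (\<Union>i\<in>I. Z i))" (is "_ = ?R")
  proof (intro equalityI subsetI)
    fix c assume c: "c \<in> ?K"
    show "c \<in> ?R"
    proof (cases "\<exists>i\<in>I. c i = 0")
      case False
      thus ?thesis
        using c by (auto simp: PiE_def Pi_def)
    next
      case True
      then obtain i where i: "i \<in> I" "c i = 0" by blast
      show ?thesis
      proof (cases "\<exists>j\<in>I-{i}. c j = 0")
        case False
        thus ?thesis
          using i c by (auto simp: Z_def)
      next
        case True
        then obtain j where j: "j \<in> I" "j \<noteq> i" "c j = 0" by blast
        have "power_sums_vanish (I - {i, j}) t d c"
          using c i j power_sums_vanish_subset[OF assms(1), of "I - {i, j}" c] by auto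
        hence "c l = 0" if "l \<in> I - {i, j}" for l
          using assms i j that
          by (intro power_sums_vanish_imp_zero[of "I - {i, j}" t d])
             (auto intro: inj_on_subset simp: card_Diff_subset)
        with i j have "c l = 0" if "l \<in> I" for l
          using that by (cases "l = i \<or> l = j") auto
        hence "c = (\<lambda>i\<in>I. 0)"
          using c by (intro PiE_ext[of c I "\<lambda>_. UNIV"]) auto
        thus ?thesis
          by simp
      qed
    qed
  next
    fix c assume "c \<in> ?R"
    thus "c \<in> ?K"
      by (auto simp: Z_def power_sums_vanish_def PiE_def)
  qed
  \<comment> \<open>A first index separates the zero word from \<open>?L\<close>, a second one
    separates it from each \<open>Z i\<close>.\<close>
  obtain i j where ij: "i \<in> I" "j \<in> I" "i \<noteq> j"
    using assms(3) by (metis card_2_iff' card_le_Suc0_iff_eq assms(1) add_2_eq_Suc' not_less_eq_eq zero_le Suc_le_mono)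
  have "card ?R = card ?L + card ({\<lambda>i\<in>I. 0} \<union> (\<Union>i\<in>I. Z i))"
    using finK K ij by (intro card_Un_disjoint) (auto intro: finite_subset simp: Z_def PiE_def Pi_def)
  also have "card ({\<lambda>i\<in>I. 0} \<union> (\<Union>i\<in>I. Z i)) = 1 + card (\<Union>i\<in>I. Z i)"
  proof (subst card_Un_disjoint)
    show "{\<lambda>i\<in>I. 0} \<inter> (\<Union>i\<in>I. Z i) = {}"
      using ij by (auto simp: Z_def)
  qed (use assms(1) finZ in simp_all)
  also have "card (\<Union>i\<in>I. Z i) = (\<Sum>i\<in>I. card (Z i))"
    using assms(1) finZ by (intro card_UN_disjoint) (auto simp: Z_def)
  also have "\<dots> = (d + 2) * (CARD('a) - 1)"
    using card_Z assms(3) by simp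
  finally have "card ?K = card ?L + (1 + (d + 2) * (CARD('a) - 1))"
    by (simp only: K[symmetric])
  moreover have "card ?K = CARD('a) ^ 2"
    using card_power_sums_vanish[OF assms(1,2), of d] assms(3) by simp
  ultimately have "real (CARD('a) ^ 2) = real (card ?L + (1 + (d + 2) * (CARD('a) - 1)))"
    by simp
  hence "real CARD('a) ^ 2 = real (card ?L) + (1 + (real d + 2) * (real CARD('a) - 1))"
    by (simp only: of_nat_add of_nat_mult of_nat_power of_nat_diff Suc_leI zero_less_card_finite
        One_nat_def) simp
  thus ?thesis
    by (simp add: algebra_simps power2_eq_square)
qed

section \<open>Affine lines\<close>

text \<open>\<open>Inl\<close> encodes vertical lines by abscissa, \<open>Inr\<close> the others by
  slope and intercept. Each affine line has exactly one code, so sums over all lines are sums over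
  \<open>UNIV\<close>.\<close>

fun line_form :: "'a::field + 'a \<times> 'a \<Rightarrow> 'a \<times> 'a \<Rightarrow> 'a" where
  "line_form (Inl a) p = fst p - a"
| "line_form (Inr (m, b)) p = snd p - (m * fst p + b)"

definition line :: "'a::field + 'a \<times> 'a \<Rightarrow> ('a \<times> 'a) set" where
  "line l = {p. line_form l p = 0}"

lemma mem_line_Inl [simp]: "p \<in> line (Inl a) \<longleftrightarrow> fst p = a"
  by (simp add: line_def)

lemma mem_line_Inr [simp]: "p \<in> line (Inr (m, b)) \<longleftrightarrow> snd p = m * fst p + b"
  by (simp add: line_def)

text \<open>Lets both kinds of line be treated alike when a dependency is multiplied by the equation
  of a line.\<close>

lemma line_form_affine:
  obtains u v w where "\<And>p. line_form l p = u + v * fst p + w * snd p"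
proof (cases l)
  case (Inl a)
  thus ?thesis
    using that[of "- a" 1 0] by simp
next
  case (Inr mb)
  thus ?thesis
    using that[of "- snd mb" "- fst mb" 1] by (cases mb) simp
qed

lemma line_through: "\<exists>l. p \<in> line l \<and> p' \<in> line l"
proof (cases "fst p = fst p'")
  case True
  thus ?thesis
    by (intro exI[of _ "Inl (fst p)"]) simp
next
  case False
  define m where "m = (snd p' - snd p) / (fst p' - fst p)"
  have "m * (fst p' - fst p) = snd p' - snd p"
    using False by (simp add: m_def)
  thus ?thesis
    by (intro exI[of _ "Inr (m, snd p - m * fst p)"]) (simp add: algebra_simps)
qed

lemma line_separating:
  assumes "p \<noteq> p'"
  shows "\<exists>l. p \<in> line l \<and> p' \<notin> line l"
proof (cases "fst p = fst p'")
  case True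
  with assms have "snd p \<noteq> snd p'"
    by (simp add: prod_eq_iff)
  thus ?thesis
    by (intro exI[of _ "Inr (0, snd p)"]) simp
next
  case False
  thus ?thesis
    by (intro exI[of _ "Inl (fst p)"]) simp
qed

text \<open>Makes the line of a collinear support unique, so that no support is counted
  twice.\<close>

lemma line_unique:
  assumes "p \<noteq> p'" "p \<in> line l" "p' \<in> line l" "p \<in> line l'" "p' \<in> line l'"
  shows "l = l'"
proof -
  have *: "m = m'" if "m * x + b = m' * x + b'" "m * x' + b = m' * x' + b'" "x \<noteq> x'"
    for m m' b b' x x' :: 'a
  proof -
    have "(m - m') * (x - x') = (m * x + b) - (m' * x + b') - ((m * x' + b) - (m' * x' + b'))"
      by (simp add: algebra_simps)
    also have "\<dots> = 0"
      using that(1,2) by simp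
    finally show ?thesis
      using that(3) by simp
  qed
  show ?thesis
  proof (cases l; cases l')
    fix mb mb' assume "l = Inr mb" "l' = Inr mb'"
    moreover obtain m b m' b' where "mb = (m, b)" "mb' = (m', b')"
      by (metis surj_pair)
    moreover from calculation assms have "fst p \<noteq> fst p'"
      by (auto simp: prod_eq_iff)
    ultimately show ?thesis
      using assms *[of m "fst p" b m' b' "fst p'"] by auto
  qed (use assms in \<open>auto simp: prod_eq_iff\<close>)
qed

section \<open>Collinearity of the support\<close>

text \<open>Codewords with support exactly \<open>I\<close>, recorded only on \<open>I\<close>: the
  words of given weight are counted support by support.\<close>

definition full_words ::
    "monomial set \<Rightarrow> 'b set \<Rightarrow> ('b \<Rightarrow> 'a::field \<times> 'a) \<Rightarrow> ('b \<Rightarrow> 'a) set" where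
  "full_words B I P =
     {c \<in> I \<rightarrow>\<^sub>E -{0}. \<forall>f\<in>B. (\<Sum>i\<in>I. c i * eval_monomial f (P i)) = 0}"

lemma affine_dependence_line_form:
  fixes P :: "'b \<Rightarrow> 'a::field \<times> 'a"
  assumes "(\<Sum>i\<in>U. w i) = 0" "(\<Sum>i\<in>U. w i * fst (P i)) = 0" "(\<Sum>i\<in>U. w i * snd (P i)) = 0"
  shows "(\<Sum>i\<in>U. w i * line_form l (P i)) = 0"
proof -
  obtain u v t where "\<And>p. line_form l p = u + v * fst p + t * snd p"
    using line_form_affine by blast
  hence "(\<Sum>i\<in>U. w i * line_form l (P i)) =
      u * (\<Sum>i\<in>U. w i) + v * (\<Sum>i\<in>U. w i * fst (P i)) + t * (\<Sum>i\<in>U. w i * snd (P i))"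
    by (simp add: sum_distrib_left sum.distrib algebra_simps)
  thus ?thesis
    using assms by simp
qed

text \<open>Two distinct points are affinely independent: a line through one that avoids the other
  leaves a single nonzero term of the dependency.\<close>

lemma affine_dependence_small:
  fixes P :: "'b \<Rightarrow> 'a::field \<times> 'a"
  assumes "finite U" "card U \<le> 2" "inj_on P U" "\<And>i. i \<in> U \<Longrightarrow> w i \<noteq> 0"
    and "(\<Sum>i\<in>U. w i) = 0" "(\<Sum>i\<in>U. w i * fst (P i)) = 0" "(\<Sum>i\<in>U. w i * snd (P i)) = 0"
  shows "U = {}"
proof -
  consider "card U = 0" | "card U = 1" | "card U = 2"
    using assms(2) by linarith
  thus ?thesis
  proof cases
    case 1
    thus ?thesis
      using assms(1) by simp
  next
    case 2
    then obtain i where "U = {i}"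
      by (rule card_1_singletonE)
    thus ?thesis
      using assms(4,5) by simp
  next
    case 3
    then obtain i j where U: "U = {i, j}" "i \<noteq> j"
      by (meson card_2_iff)
    with assms(3) obtain l where "P i \<in> line l" "P j \<notin> line l"
      using line_separating[of "P i" "P j"] by auto
    thus ?thesis
      using affine_dependence_line_form[OF assms(5-7), of l] U assms(4) by (simp add: line_def)
  qed
qed

text \<open>The equation of the line through two of the points kills their terms; the third term
  then vanishes although its coefficient is nonzero.\<close>

lemma affine_dependence_collinear:
  fixes P :: "'b \<Rightarrow> 'a::field \<times> 'a"
  assumes "card U = 3" "\<And>i. i \<in> U \<Longrightarrow> w i \<noteq> 0"
    and "(\<Sum>i\<in>U. w i) = 0" "(\<Sum>i\<in>U. w i * fst (P i)) = 0" "(\<Sum>i\<in>U. w i * snd (P i)) = 0"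
  shows "\<exists>l. P ` U \<subseteq> line l"
proof -
  obtain i j k where U: "U = {i, j, k}" "i \<noteq> j" "i \<noteq> k" "j \<noteq> k"
    using assms(1) by (auto simp: card_3_iff)
  obtain l where l: "P i \<in> line l" "P j \<in> line l"
    using line_through by blast
  have "P k \<in> line l"
    using affine_dependence_line_form[OF assms(3-5), of l] U l assms(2) by (simp add: line_def)
  thus ?thesis
    using U l by auto
qed

text \<open>Multiplying a dependency of conics by the equation of a line gives a dependency of affine
  functions supported off that line.\<close>

lemma corner_word_residual:
  fixes P :: "'b \<Rightarrow> 'a::field \<times> 'a" and l :: "'a + 'a \<times> 'a"
  assumes "finite I" "c \<in> full_words corner_checks I P"
  defines "w \<equiv> (\<lambda>i. c i * line_form l (P i))" and "U \<equiv> {i \<in> I. P i \<notin> line l}"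
  shows "i \<in> U \<Longrightarrow> w i \<noteq> 0"
    and "(\<Sum>i\<in>U. w i) = 0" "(\<Sum>i\<in>U. w i * fst (P i)) = 0" "(\<Sum>i\<in>U. w i * snd (P i)) = 0"
proof -
  show "w i \<noteq> 0" if "i \<in> U"
    using that assms(2) by (auto simp: w_def U_def full_words_def line_def PiE_def Pi_def)
  obtain u v t where form: "\<And>p. line_form l p = u + v * fst p + t * snd p"
    using line_form_affine by blast
  have U: "(\<Sum>i\<in>U. w i * g i) = (\<Sum>i\<in>I. w i * g i)" for g
    using assms(1) by (intro sum.mono_neutral_left) (auto simp: w_def U_def line_def)
  have checks: "(\<Sum>i\<in>I. c i) = 0"
      "(\<Sum>i\<in>I. c i * fst (P i)) = 0" "(\<Sum>i\<in>I. c i * snd (P i)) = 0"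
      "(\<Sum>i\<in>I. c i * fst (P i) ^ 2) = 0" "(\<Sum>i\<in>I. c i * (fst (P i) * snd (P i))) = 0"
      "(\<Sum>i\<in>I. c i * snd (P i) ^ 2) = 0"
    using assms(2) by (simp_all add: full_words_def corner_checks_def eval_monomial_def)
  have "(\<Sum>i\<in>I. w i * 1) = u * (\<Sum>i\<in>I. c i) + v * (\<Sum>i\<in>I. c i * fst (P i))
      + t * (\<Sum>i\<in>I. c i * snd (P i))"
    by (simp add: w_def form sum_distrib_left sum.distrib algebra_simps)
  thus "(\<Sum>i\<in>U. w i) = 0"
    using U[of "\<lambda>_. 1"] checks by simp
  have "(\<Sum>i\<in>I. w i * fst (P i)) = u * (\<Sum>i\<in>I. c i * fst (P i))
      + v * (\<Sum>i\<in>I. c i * fst (P i) ^ 2) + t * (\<Sum>i\<in>I. c i * (fst (P i) * snd (P i)))"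
    by (simp add: w_def form sum_distrib_left sum.distrib algebra_simps power2_eq_square)
  thus "(\<Sum>i\<in>U. w i * fst (P i)) = 0"
    using U checks by simp
  have "(\<Sum>i\<in>I. w i * snd (P i)) = u * (\<Sum>i\<in>I. c i * snd (P i))
      + v * (\<Sum>i\<in>I. c i * (fst (P i) * snd (P i))) + t * (\<Sum>i\<in>I. c i * snd (P i) ^ 2)"
    by (simp add: w_def form sum_distrib_left sum.distrib algebra_simps power2_eq_square)
  thus "(\<Sum>i\<in>U. w i * snd (P i)) = 0"
    using U checks by simp
qed

text \<open>A line through two of the points misses at most three. If it misses at most two, the
  residual dependency shows that it misses none. If it misses three, these lie on a line
  \<open>l'\<close>, which can miss only the two remaining points, and the first case applies to
  \<open>l'\<close>.\<close>

lemma corner_word_collinear: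
  assumes "inj_on P I" "card I = 5" "c \<in> full_words corner_checks I P"
  shows "\<exists>l. P ` I \<subseteq> line l"
proof -
  have fin: "finite I"
    using assms(2) by (simp add: card_ge_0_finite)
  note residual = corner_word_residual[OF fin assms(3)]
  have small: "P ` I \<subseteq> line l" if "card {i \<in> I. P i \<notin> line l} \<le> 2" for l
  proof -
    have "{i \<in> I. P i \<notin> line l} = {}"
      by (rule affine_dependence_small[OF _ that _ residual])
         (use fin assms(1) in \<open>auto intro: inj_on_subset\<close>)
    thus ?thesis
      by auto
  qed
  obtain J where J: "J \<subseteq> I" "card J = 2"
    using obtain_subset_with_card_n[of 2 I] assms(2) by auto
  then obtain i j where ij: "J = {i, j}"
    by (meson card_2_iff)
  obtain l where l: "P i \<in> line l" "P j \<in> line l"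
    using line_through by blast
  define U where "U = {i \<in> I. P i \<notin> line l}"
  have "card U \<le> card (I - J)"
    using fin l ij by (intro card_mono) (auto simp: U_def)
  also have "card (I - J) = 3"
    using J assms(2) fin by (simp add: card_Diff_subset finite_subset)
  finally consider "card U \<le> 2" | "card U = 3"
    by linarith
  thus ?thesis
  proof cases
    case 1
    thus ?thesis
      using small[of l] by (auto simp: U_def)
  next
    case 2
    then obtain l' where l': "P ` U \<subseteq> line l'"
      using affine_dependence_collinear[OF _ residual] unfolding U_def by blast
    have "card {i \<in> I. P i \<notin> line l'} \<le> card (I - U)"
      using fin l' by (intro card_mono) auto
    also have "\<dots> = 2"
      using fin 2 assms(2) by (subst card_Diff_subset) (auto simp: U_def)
    finally show ?thesis
      using small by blast
  qed
qed

text \<open>On \<open>I\<close> the checks and the powers \<open>t ^ k\<close> with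
  \<open>k < d\<close> span the same functions: the first hypothesis finds each power among the
  checks, the second writes each check as a polynomial in \<open>t\<close>.\<close>

lemma full_words_eq_power_sums:
  assumes "\<And>k. k < d \<Longrightarrow> \<exists>f\<in>B. \<forall>i\<in>I. eval_monomial f (P i) = t i ^ k"
    and "\<And>f. f \<in> B \<Longrightarrow> \<exists>p. degree p < d \<and> (\<forall>i\<in>I. eval_monomial f (P i) = poly p (t i))"
  shows "full_words B I P = {c \<in> I \<rightarrow>\<^sub>E -{0}. power_sums_vanish I t d c}"
proof -
  have "(\<forall>f\<in>B. (\<Sum>i\<in>I. c i * eval_monomial f (P i)) = 0) \<longleftrightarrow> power_sums_vanish I t d c" for c
  proof
    assume c: "\<forall>f\<in>B. (\<Sum>i\<in>I. c i * eval_monomial f (P i)) = 0"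
    show "power_sums_vanish I t d c"
      unfolding power_sums_vanish_def
    proof (intro allI impI)
      fix k assume "k < d"
      then obtain f where f: "f \<in> B" "\<forall>i\<in>I. eval_monomial f (P i) = t i ^ k"
        using assms(1) by blast
      hence "(\<Sum>i\<in>I. c i * t i ^ k) = (\<Sum>i\<in>I. c i * eval_monomial f (P i))"
        by (intro sum.cong) auto
      also have "\<dots> = 0"
        using c f(1) by blast
      finally show "(\<Sum>i\<in>I. c i * t i ^ k) = 0" .
    qed
  next
    assume c: "power_sums_vanish I t d c"
    show "\<forall>f\<in>B. (\<Sum>i\<in>I. c i * eval_monomial f (P i)) = 0"
    proof
      fix f assume "f \<in> B"
      then obtain p where p: "degree p < d" "\<forall>i\<in>I. eval_monomial f (P i) = poly p (t i)"
        using assms(2) by blast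
      hence "(\<Sum>i\<in>I. c i * eval_monomial f (P i)) = (\<Sum>i\<in>I. c i * poly p (t i))"
        by (intro sum.cong) auto
      thus "(\<Sum>i\<in>I. c i * eval_monomial f (P i)) = 0"
        using power_sums_vanish_poly[OF c p(1)] by simp
    qed
  qed
  thus ?thesis
    by (simp add: full_words_def)
qed

section \<open>The parity checks restricted to vertical and non-vertical lines\<close>

lemma corner_subset_H4_checks: "corner_checks \<subseteq> H4_checks j"
  by (simp add: H4_checks_def)

lemma H4_checks_subset: "H4_checks j \<subseteq> corner_checks \<union> {(3,0), (2,1), (1,2)}"
  using set_take_subset[of j "[(3,0), (2,1), (1::nat,2::nat)]"] by (auto simp: H4_checks_def)

text \<open>For \<open>x = a\<close> each check is a constant times a power of \<open>y\<close>, of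
  exponent at most 2 even for the cubic checks. So \<open>d = 3\<close> for every \<open>j\<close>,
  and five points leave a code of dimension 2.\<close>

lemma card_full_words_vertical:
  fixes P :: "'b \<Rightarrow> 'a::{field,finite} \<times> 'a"
  assumes "inj_on P I" "card I = 5" "P ` I \<subseteq> line (Inl a)"
  shows "real (card (full_words (H4_checks j) I P)) = (real CARD('a) - 1) * (real CARD('a) - 4)"
proof -
  have fst: "fst (P i) = a" if "i \<in> I" for i
    using assms(3) that by auto
  have "full_words (H4_checks j) I P =
      {c \<in> I \<rightarrow>\<^sub>E -{0}. power_sums_vanish I (\<lambda>i. snd (P i)) 3 c}"
  proof (rule full_words_eq_power_sums)
    fix k :: nat assume "k < 3"
    hence "(0, k) \<in> H4_checks j"
      using corner_subset_H4_checks by (force simp: corner_checks_def less_Suc_eq numeral_eq_Suc)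
    thus "\<exists>f\<in>H4_checks j. \<forall>i\<in>I. eval_monomial f (P i) = snd (P i) ^ k"
      by (intro bexI[of _ "(0, k)"]) (auto simp: eval_monomial_def)
  next
    fix f assume "f \<in> H4_checks j"
    hence "snd f < 3"
      using H4_checks_subset[of j] by (auto simp: corner_checks_def)
    thus "\<exists>p. degree p < 3 \<and> (\<forall>i\<in>I. eval_monomial f (P i) = poly p (snd (P i)))"
      using degree_monom_le[of "a ^ fst f" "snd f"] fst
      by (intro exI[of _ "monom (a ^ fst f) (snd f)"])
         (auto simp: eval_monomial_def poly_monom)
  qed
  moreover have "inj_on (\<lambda>i. snd (P i)) I"
    using assms(1) fst by (auto simp: inj_on_def prod_eq_iff)
  ultimately show ?thesis
    using card_nonzero_power_sums_vanish_2[of I "\<lambda>i. snd (P i)" 3] assms(2)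
    by (simp add: card_ge_0_finite)
qed

text \<open>Substituting \<open>y = m x + b\<close> turns a monomial into a polynomial in
  \<open>x\<close> of at most its total degree. The powers up to \<open>x^2\<close> are corner
  checks and \<open>x^3\<close> is the first cubic check, so all edge codes share
  \<open>d = 4\<close>.\<close>

lemma full_words_nonvertical:
  fixes P :: "'b \<Rightarrow> 'a::field \<times> 'a"
  assumes "P ` I \<subseteq> line (Inr (m, b))"
  shows "full_words (H4_checks j) I P =
    {c \<in> I \<rightarrow>\<^sub>E -{0}. power_sums_vanish I (\<lambda>i. fst (P i)) (if j = 0 then 3 else 4) c}"
proof (rule full_words_eq_power_sums)
  fix k :: nat assume k: "k < (if j = 0 then 3 else 4)"
  have "(k, 0) \<in> H4_checks j"
  proof (cases "k = 3")
    case True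
    thus ?thesis
      using k by (cases j) (auto simp: H4_checks_def)
  next
    case False
    hence "k < 3"
      using k by (auto split: if_splits)
    thus ?thesis
      using corner_subset_H4_checks by (force simp: corner_checks_def less_Suc_eq numeral_eq_Suc)
  qed
  thus "\<exists>f\<in>H4_checks j. \<forall>i\<in>I. eval_monomial f (P i) = fst (P i) ^ k"
    by (intro bexI[of _ "(k, 0)"]) (auto simp: eval_monomial_def)
next
  fix f assume f: "f \<in> H4_checks j"
  define p where "p = monom 1 (fst f) * [:b, m:] ^ snd f"
  have "degree p \<le> degree (monom (1::'a) (fst f)) + degree ([:b, m:] ^ snd f)"
    unfolding p_def by (rule degree_mult_le)
  also have "\<dots> \<le> fst f + snd f"
    using degree_power_le[of "[:b, m:]" "snd f"]
    by (intro add_mono degree_monom_le) (auto split: if_splits)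
  also have "\<dots> < (if j = 0 then 3 else 4)"
    using f H4_checks_subset[of j] by (auto simp: corner_checks_def H4_checks_def)
  finally have "degree p < (if j = 0 then 3 else 4)" .
  moreover have "eval_monomial f (P i) = poly p (fst (P i))" if "i \<in> I" for i
  proof -
    have "snd (P i) = m * fst (P i) + b"
      using assms that by auto
    thus ?thesis
      by (simp add: eval_monomial_def p_def poly_monom poly_power algebra_simps)
  qed
  ultimately show "\<exists>p. degree p < (if j = 0 then 3 else 4) \<and>
      (\<forall>i\<in>I. eval_monomial f (P i) = poly p (fst (P i)))"
    by blast
qed

lemma inj_on_fst_nonvertical:
  assumes "inj_on P I" "P ` I \<subseteq> line (Inr (m, b))"
  shows "inj_on (\<lambda>i. fst (P i)) I"
proof (rule inj_onI)
  fix i j assume ij: "i \<in> I" "j \<in> I" "fst (P i) = fst (P j)"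
  hence "snd (P i) = snd (P j)"
    using assms(2) by (metis image_subset_iff mem_line_Inr)
  thus "i = j"
    using assms(1) ij by (metis inj_onD prod_eq_iff)
qed

text \<open>With \<open>d = 3\<close> the five nodes are \<open>d + 2\<close> in number, which gives
  the same count as on a vertical line.\<close>

lemma card_full_words_nonvertical_corner:
  fixes P :: "'b \<Rightarrow> 'a::{field,finite} \<times> 'a"
  assumes "inj_on P I" "card I = 5" "P ` I \<subseteq> line (Inr (m, b))"
  shows "real (card (full_words (H4_checks 0) I P)) = (real CARD('a) - 1) * (real CARD('a) - 4)"
  using card_nonzero_power_sums_vanish_2[OF _ inj_on_fst_nonvertical[OF assms(1,3)], of 3] assms(2)
  by (simp add: full_words_nonvertical[OF assms(3)] card_ge_0_finite)

text \<open>The check \<open>x^3\<close> raises \<open>d\<close> to 4, so dimension 1 remains: the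
  nonzero multiples of one word.\<close>

lemma card_full_words_nonvertical_edge:
  fixes P :: "'b \<Rightarrow> 'a::{field,finite} \<times> 'a"
  assumes "inj_on P I" "card I = 5" "P ` I \<subseteq> line (Inr (m, b))" "j > 0"
  shows "real (card (full_words (H4_checks j) I P)) = real CARD('a) - 1"
  using card_nonzero_power_sums_vanish_1[OF _ inj_on_fst_nonvertical[OF assms(1,3)], of 4] assms(2,4)
  by (simp add: full_words_nonvertical[OF assms(3)] card_ge_0_finite of_nat_diff Suc_leI)

section \<open>Counting words by support\<close>

text \<open>Words are sorted by support; restriction to the support is inverted by extension with
  zeros.\<close>

lemma num_words_of_weight_eq_sum:
  fixes P :: "nat \<Rightarrow> 'a::{field,finite} \<times> 'a"
  shows "num_words_of_weight n k (code_of_checks n P B) =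
    (\<Sum>I | I \<subseteq> {1..n} \<and> card I = k. card (full_words B I P))"
proof -
  define supp where "supp c = {i \<in> {1..n}. c i \<noteq> (0::'a)}" for c
  define W where "W I = {c \<in> code_of_checks n P B. supp c = I}" for I
  have fin_words: "finite (words n :: (nat \<Rightarrow> 'a) set)"
    unfolding words_def by (rule finite_PiE) auto
  have fin_W: "finite (W I)" for I
    by (rule finite_subset[OF _ fin_words]) (auto simp: W_def code_of_checks_def)
  have "{c \<in> code_of_checks n P B. weight n c = k} = (\<Union>I\<in>{I. I \<subseteq> {1..n} \<and> card I = k}. W I)"
    by (auto simp: W_def supp_def weight_def)
  hence "num_words_of_weight n k (code_of_checks n P B) =
      (\<Sum>I | I \<subseteq> {1..n} \<and> card I = k. card (W I))"
    unfolding num_words_of_weight_def using fin_W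
    by (simp only:) (intro card_UN_disjoint, auto simp: W_def)
  also have "card (W I) = card (full_words B I P)" if I: "I \<subseteq> {1..n}" for I
  proof (rule bij_betw_same_card)
    have sum_eq: "(\<Sum>i=1..n. c i * g i) = (\<Sum>i\<in>I. c i * g i)"
      if "\<And>i. i \<in> {1..n} - I \<Longrightarrow> c i = 0" for c g :: "nat \<Rightarrow> 'a"
      using I that by (intro sum.mono_neutral_right) auto
    show "bij_betw (\<lambda>c. restrict c I) (W I) (full_words B I P)"
    proof (rule bij_betw_byWitness[where f' = "\<lambda>c. \<lambda>i\<in>{1..n}. if i \<in> I then c i else 0"])
      show "\<forall>c\<in>W I. (\<lambda>i\<in>{1..n}. if i \<in> I then restrict c I i else 0) = c"
        by (auto simp: W_def supp_def code_of_checks_def words_def fun_eq_iff PiE_def extensional_def)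
      show "\<forall>c\<in>full_words B I P. restrict (\<lambda>i\<in>{1..n}. if i \<in> I then c i else 0) I = c"
      proof
        fix c assume "c \<in> full_words B I P"
        thus "restrict (\<lambda>i\<in>{1..n}. if i \<in> I then c i else 0) I = c"
          by (intro extensionalityI[of _ I]) (use I in \<open>auto simp: full_words_def PiE_def\<close>)
      qed
      show "(\<lambda>c. restrict c I) ` W I \<subseteq> full_words B I P"
      proof clarify
        fix c assume c: "c \<in> W I"
        have "(\<Sum>i=1..n. c i * g i) = (\<Sum>i\<in>I. c i * g i)" for g
          using c by (intro sum_eq) (auto simp: W_def supp_def)
        thus "restrict c I \<in> full_words B I P"
          using c by (auto simp: W_def supp_def code_of_checks_def full_words_def)
      qed
      show "(\<lambda>c. \<lambda>i\<in>{1..n}. if i \<in> I then c i else 0) ` full_words B I P \<subseteq> W I"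
      proof clarify
        fix c assume c: "c \<in> full_words B I P"
        define c' where "c' = (\<lambda>i\<in>{1..n}. if i \<in> I then c i else 0)"
        have "(\<Sum>i=1..n. c' i * g i) = (\<Sum>i\<in>I. c' i * g i)" for g
          by (intro sum_eq) (auto simp: c'_def)
        also have "(\<Sum>i\<in>I. c' i * g i) = (\<Sum>i\<in>I. c i * g i)" for g
          using I by (intro sum.cong) (auto simp: c'_def)
        finally have "c' \<in> code_of_checks n P B"
          using c by (auto simp: code_of_checks_def full_words_def words_def c'_def)
        moreover have "supp c' = I"
          using I c by (auto simp: supp_def c'_def full_words_def PiE_def Pi_def)
        ultimately show "c' \<in> W I"
          by (simp add: W_def)
      qed
    qed
  qed
  hence "(\<Sum>I | I \<subseteq> {1..n} \<and> card I = k. card (W I)) =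
      (\<Sum>I | I \<subseteq> {1..n} \<and> card I = k. card (full_words B I P))"
    by (intro sum.cong) auto
  finally show ?thesis .
qed

text \<open>Supports are sorted by the line that contains them. The value \<open>v l\<close> may
  depend on the line, since on the edge codes vertical and non-vertical lines behave
  differently.\<close>

lemma num_words_of_weight_5_H4:
  fixes P :: "nat \<Rightarrow> 'a::{field,finite} \<times> 'a"
  assumes inj: "inj_on P {1..n}"
    and v: "\<And>I l. I \<subseteq> {1..n} \<Longrightarrow> card I = 5 \<Longrightarrow> P ` I \<subseteq> line l \<Longrightarrow>
      real (card (full_words (H4_checks j) I P)) = v l"
  shows "real (num_words_of_weight n 5 (H4 n P j)) =
    (\<Sum>l\<in>UNIV. real (card (P ` {1..n} \<inter> line l) choose 5) * v l)"
proof -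
  define N where "N I = real (card (full_words (H4_checks j) I P))" for I
  define F where "F = {I. I \<subseteq> {1..n} \<and> card I = 5}"
  define K where "K l = {I \<in> F. P ` I \<subseteq> line l}" for l :: "'a + 'a \<times> 'a"
  have fin_F: "finite F"
    by (rule finite_subset[of _ "Pow {1..n}"]) (auto simp: F_def)
  have sum_K: "(\<Sum>I\<in>K l. N I) = real (card (P ` {1..n} \<inter> line l) choose 5) * v l" for l
  proof -
    define S where "S = {i \<in> {1..n}. P i \<in> line l}"
    have "K l = {I. I \<subseteq> S \<and> card I = 5}"
      by (auto simp: K_def F_def S_def)
    hence "card (K l) = card S choose 5"
      by (simp add: n_subsets S_def)
    also have "card S = card (P ` S)"
      using inj by (intro card_image[symmetric]) (auto simp: S_def intro: inj_on_subset)
    also have "P ` S = P ` {1..n} \<inter> line l"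
      by (auto simp: S_def)
    finally have "card (K l) = card (P ` {1..n} \<inter> line l) choose 5" .
    moreover have "(\<Sum>I\<in>K l. N I) = (\<Sum>I\<in>K l. v l)"
      using v by (intro sum.cong) (auto simp: K_def F_def N_def)
    ultimately show ?thesis
      by simp
  qed
  have "real (num_words_of_weight n 5 (H4 n P j)) = (\<Sum>I\<in>F. N I)"
    by (simp add: H4_def num_words_of_weight_eq_sum F_def N_def)
  \<comment> \<open>Non-collinear supports carry no word by \<open>corner_word_collinear\<close>, as
    every code here lies in the corner code.\<close>
  also have "\<dots> = (\<Sum>I\<in>(\<Union>l\<in>UNIV. K l). N I)"
  proof (rule sum.mono_neutral_right)
    show "\<forall>I\<in>F - (\<Union>l\<in>UNIV. K l). N I = 0"
    proof
      fix I assume I: "I \<in> F - (\<Union>l\<in>UNIV. K l)"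
      have "full_words (H4_checks j) I P = {}"
      proof (rule ccontr)
        assume "full_words (H4_checks j) I P \<noteq> {}"
        then obtain c where "c \<in> full_words corner_checks I P"
          using corner_subset_H4_checks[of j] by (auto simp: full_words_def)
        hence "\<exists>l. P ` I \<subseteq> line l"
          using I inj by (intro corner_word_collinear) (auto simp: F_def intro: inj_on_subset)
        thus False
          using I by (auto simp: K_def)
      qed
      thus "N I = 0"
        by (simp add: N_def)
    qed
  qed (use fin_F in \<open>auto simp: K_def\<close>)
  \<comment> \<open>Five distinct points lie on at most one line, so the families \<open>K l\<close>
    are disjoint.\<close>
  also have "\<dots> = (\<Sum>l\<in>UNIV. \<Sum>I\<in>K l. N I)"
  proof (rule sum.UNION_disjoint)
    show "\<forall>l\<in>UNIV. \<forall>l'\<in>UNIV. l \<noteq> l' \<longrightarrow> K l \<inter> K l' = {}"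
    proof (intro ballI impI, rule ccontr)
      fix l l' :: "'a + 'a \<times> 'a" assume "l \<noteq> l'" "K l \<inter> K l' \<noteq> {}"
      then obtain I where I: "I \<in> F" "P ` I \<subseteq> line l" "P ` I \<subseteq> line l'"
        by (auto simp: K_def)
      have "2 \<le> card I"
        using I(1) by (simp add: F_def)
      then obtain J where "J \<subseteq> I" "card J = 2"
        by (meson obtain_subset_with_card_n)
      then obtain i k where ik: "i \<in> I" "k \<in> I" "i \<noteq> k"
        by (auto simp: card_2_iff)
      hence "P i \<noteq> P k"
        using inj I(1) by (auto simp: F_def inj_on_def)
      hence "l = l'"
        using I ik by (intro line_unique[of "P i" "P k"]) auto
      thus False
        using \<open>l \<noteq> l'\<close> by simp
    qed
  qed (use fin_F in \<open>auto simp: K_def\<close>)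
  finally show ?thesis
    by (simp only: sum_K)
qed

section \<open>The sum over all lines for the Hermitian curve\<close>

context square_order_field
begin

lemma card_curve_inter_vertical:
  "card (hermitian_curve q \<inter> line (Inl (a::'a))) = q"
proof -
  have "hermitian_curve q \<inter> line (Inl a) = Pair a ` {y. (a, y) \<in> hermitian_curve q}"
    by auto
  thus ?thesis
    using card_curve_vertical[of a] by (simp add: card_image inj_on_def)
qed

lemma card_curve_inter_nonvertical:
  "card (hermitian_curve q \<inter> line (Inr (m::'a, b))) =
    (if b ^ q + b = - (m ^ (q + 1)) then 1 else q + 1)"
proof -
  have "hermitian_curve q \<inter> line (Inr (m, b)) =
      (\<lambda>x. (x, m * x + b)) ` {x. (x, m * x + b) \<in> hermitian_curve q}"
    by auto
  thus ?thesis
    using card_curve_nonvertical[of m b] by (simp add: card_image inj_on_def)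
qed

text \<open>There are \<open>q ^ 2\<close> vertical lines with \<open>q\<close> points each and
  \<open>q ^ 4 - q ^ 3\<close> non-tangent others with \<open>q + 1\<close>. Vertical lines
  contribute equally to all the codes; only the value \<open>v\<close> tells corner from
  edge.\<close>

lemma num_words_of_weight_5_hermitian:
  fixes P :: "nat \<Rightarrow> 'a \<times> 'a" and v :: real
  assumes bij: "bij_betw P {1..n} (hermitian_curve q)"
    and nonvertical: "\<And>I m b. inj_on P I \<Longrightarrow> card I = 5 \<Longrightarrow>
      P ` I \<subseteq> line (Inr (m, b)) \<Longrightarrow> real (card (full_words (H4_checks j) I P)) = v"
  shows "real (num_words_of_weight n 5 (H4 n P j)) =
    real q ^ 2 * real (q choose 5) * ((real q ^ 2 - 1) * (real q ^ 2 - 4))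
      + (real q ^ 4 - real q ^ 3) * real ((q + 1) choose 5) * v"
proof -
  define u where "u = (real q ^ 2 - 1) * (real q ^ 2 - 4)"
  have inj: "inj_on P {1..n}" and img: "P ` {1..n} = hermitian_curve q"
    using bij by (auto simp: bij_betw_def)
  define T where "T = {(m::'a, b). b ^ q + b = - (m ^ (q + 1))}"
  have "real (card (full_words (H4_checks j) I P)) = (case l of Inl _ \<Rightarrow> u | Inr _ \<Rightarrow> v)"
    if "I \<subseteq> {1..n}" "card I = 5" "P ` I \<subseteq> line l" for I l
  proof (cases l)
    case (Inl a)
    thus ?thesis
      using card_full_words_vertical[of P I a j] inj_on_subset[OF inj that(1)] that(2,3)
      by (simp add: u_def card_field)
  next
    case (Inr mb)
    thus ?thesis
      using nonvertical[of I] inj_on_subset[OF inj that(1)] that(2,3) by (cases mb) simp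
  qed
  hence "real (num_words_of_weight n 5 (H4 n P j)) =
      (\<Sum>l\<in>(UNIV :: ('a + 'a \<times> 'a) set). real (card (hermitian_curve q \<inter> line l) choose 5) *
        (case l of Inl _ \<Rightarrow> u | Inr _ \<Rightarrow> v))"
    unfolding img[symmetric] by (intro num_words_of_weight_5_H4[OF inj]) blast
  also have "\<dots> = (\<Sum>a\<in>(UNIV::'a set). real (q choose 5) * u) +
      (\<Sum>mb\<in>UNIV. real (card (hermitian_curve q \<inter> line (Inr mb :: 'a + 'a \<times> 'a)) choose 5) * v)"
    by (simp add: card_curve_inter_vertical sum.Plus flip: UNIV_Plus_UNIV)
  \<comment> \<open>The tangents \<open>T\<close> drop out because
    \<open>1 choose 5 = 0\<close>.\<close>
  also have "(\<Sum>mb\<in>UNIV. real (card (hermitian_curve q \<inter> line (Inr mb :: 'a + 'a \<times> 'a)) choose 5) * v) =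
      (\<Sum>mb\<in>-T. real ((q + 1) choose 5) * v)"
    by (rule sum.mono_neutral_cong_right) (auto simp: T_def card_curve_inter_nonvertical)
  finally have total: "real (num_words_of_weight n 5 (H4 n P j)) =
      real q ^ 2 * (real (q choose 5) * u) + real (card (-T)) * (real ((q + 1) choose 5) * v)"
    by (simp add: card_field)
  have "card T = q ^ 3"
    using card_tangents by (simp add: T_def)
  moreover have "card T + card (-T) = CARD('a \<times> 'a)"
    by (subst card_Un_disjoint[symmetric]) auto
  hence "card T + card (-T) = q ^ 4"
    by (simp add: card_field card_prod flip: UNIV_Times_UNIV power_add)
  ultimately have "real (card (-T)) = real q ^ 4 - real q ^ 3"
    by (metis add_diff_cancel_left' of_nat_add of_nat_power)
  thus ?thesis
    using total by (simp add: u_def)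
qed

end

theorem theorem4p14:
  fixes q n :: nat
    and P :: "nat \<Rightarrow> 'a::{field,finite} \<times> 'a"
  assumes "primepow q"
    and "q \<ge> 4"
    and "CARD('a) = q ^ 2"
    and "n = card (hermitian_curve q :: ('a \<times> 'a) set)"
    and "bij_betw P {1..n} (hermitian_curve q)"
  shows "real (num_words_of_weight n 5 (H4 n P 0)) =
           1 / 5 * real q ^ 2 * real (q choose 4)
             * (real q ^ 3 - 4) * (real q ^ 2 - 1) * (real q ^ 2 - 4)
       \<and> (\<forall>j\<in>{1..3}. real (num_words_of_weight n 5 (H4 n P j)) =
           real q ^ 2 * (real q - 1) * real ((q + 1) choose 5)
             * (2 * real q ^ 3 - 4 * real q ^ 2 - 5 * real q + 16))"
proof -
  interpret square_order_field q "TYPE('a)"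
    using assms(1,3) by unfold_locales
  \<comment> \<open>Absorption and then Pascal's rule express both binomials through
    \<open>q choose 4\<close>, which turns the two formulas into polynomial identities in
    \<open>q\<close>.\<close>
  define X where "X = real (q choose 4)"
  have "real (5 * (Suc q choose 5)) = real (Suc q * (q choose 4))"
    using Suc_times_binomial[of 4 q] by (simp only: eval_nat_numeral)
  hence "5 * real ((q + 1) choose 5) = (real q + 1) * X"
    by (simp add: X_def algebra_simps)
  hence X1: "real ((q + 1) choose 5) = (real q + 1) * X / 5"
    by simp
  have "(q + 1) choose 5 = (q choose 4) + (q choose 5)"
    using binomial_Suc_Suc[of q 4] by (simp add: eval_nat_numeral)
  hence X0: "real (q choose 5) = (real q - 4) * X / 5"
    using X1 by (simp add: X_def field_simps)
  \<comment> \<open>All lines share the factor \<open>(q^2 - 1) (q^2 - 4)\<close>; the two kinds of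
    line add up to \<open>(q - 4) + q (q - 1) (q + 1) = q^3 - 4\<close>.\<close>
  have "real (num_words_of_weight n 5 (H4 n P 0)) =
      1 / 5 * real q ^ 2 * X * (real q ^ 3 - 4) * (real q ^ 2 - 1) * (real q ^ 2 - 4)"
    by (subst num_words_of_weight_5_hermitian[OF assms(5) card_full_words_nonvertical_corner],
        assumption+)
       (simp only: X0 X1 card_field of_nat_power, simp add: field_simps power_numeral_reduce)
  \<comment> \<open>Here the common factor is \<open>q^2 - 1\<close>, and the last bracket of the
    formula is \<open>(q - 4) (q^2 - 4) + q (q^2 - 1)\<close>.\<close>
  moreover have "real (num_words_of_weight n 5 (H4 n P j)) =
      real q ^ 2 * (real q - 1) * ((real q + 1) * X / 5)
        * (2 * real q ^ 3 - 4 * real q ^ 2 - 5 * real q + 16)" if "j \<in> {1..3}" for j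
    by (subst num_words_of_weight_5_hermitian[OF assms(5) card_full_words_nonvertical_edge],
        assumption+)
       (use that in \<open>simp, simp only: X0 X1 card_field of_nat_power,
        simp add: field_simps power_numeral_reduce\<close>)
  ultimately show ?thesis
    by (simp only: X_def X1) simp
qed

end
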